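(* Let $T,D,a\in\mathbb{R}$ with $a^2+D^2\ne 0$, let $W(y)=Dy^2-aTy+a^2$, and let $P:I\to(-\infty,0]$ be the left Poincaré half-map of the system $\dot x=Tx-y$, $\dot y=Dx-a$ associated to $\Sigma=\{x=0\}$. Assume that $0\in I$. If $P(0)=\hat y_1<0$, then $a<0$, $T>0$, $4D-T^2>0$, $\hat y_1$ is the right endpoint of the interval $P(I)$, the map $P$ is a real analytic function in $I$, and its Taylor expansion around the origin is $$ \begin{aligned} P(y_0)={}&\hat y_1+\frac{W(\hat y_1)\,y_0^2}{2a^2\hat y_1}+\frac{T\,W(\hat y_1)\,y_0^3}{3a^3\hat y_1}-\frac{\left(a^2+(D-2T^2)\hat y_1^2\right)W(\hat y_1)\,y_0^4}{8a^4\hat y_1^3}\\ &-\frac{T\left(5a^2+(7D-6T^2)\hat y_1^2\right)W(\hat y_1)\,y_0^5}{30a^5\hat y_1^3}\\ &+\frac{\left(9a^4-6a^3T\hat y_1+2a^2(9D-13T^2)\hat y_1^2+(9D^2-46DT^2+24T^4)\hat y_1^4\right)W(\hat y_1)\,y_0^6}{144a^6\hat y_1^5}+\mathcal{O}\left(y_0^7\right). \end{aligned} $$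
   Context: Let $T,D,a\in\mathbb{R}$ with $a^2+D^2\neq0$ (standing assumption) and consider the planar linear system $\dot x=Tx-y$, $\dot y=Dx-a$, with Poincaré section $\Sigma=\{(x,y)\in\mathbb{R}^2:x=0\}$. Left Poincaré half-map $P$: for $y_0\geqslant0$ let $\Phi(t;y_0)=(\Phi_1(t;y_0),\Phi_2(t;y_0))$ be the solution with $\Phi(0;y_0)=(0,y_0)$. If there exists $\tau(y_0)>0$ such that $\Phi_1(\tau(y_0);y_0)=0$ and $\Phi_1(t;y_0)<0$ for every $t\in(0,\tau(y_0))$, put $P(y_0)=\Phi_2(\tau(y_0);y_0)\leqslant0$. If $P(0)$ is not defined by this rule, but for every $\varepsilon>0$ there exist $y_0\in(0,\varepsilon)$ and $y_1\in(-\varepsilon,0)$ with $P(y_0)=y_1$, then $P$ is extended continuously by $P(0)=0$. The domain of $P$ is the interval $I\subset[0,+\infty)$ of all $y_0$ where $P$ is so defined. Real analyticity in $I$ at an endpoint belonging to $I$ means that $P$ coincides on $I$ near that point with a function that is real analytic in a neighbourhood of that point. *)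

theory Defs
  imports "HOL-Analysis.Analysis" "HOL-Library.Landau_Symbols"
begin

definition is_solution ::
  "real \<Rightarrow> real \<Rightarrow> real \<Rightarrow> (real \<Rightarrow> real) \<Rightarrow> (real \<Rightarrow> real) \<Rightarrow> bool" where
  "is_solution T D a x y \<longleftrightarrow>
     (\<forall>t. (x has_real_derivative T * x t - y t) (at t)) \<and>
     (\<forall>t. (y has_real_derivative D * x t - a) (at t))"

text \<open>The orbit starting at \<open>(0, y0)\<close> first comes back to the section \<open>x = 0\<close>,
  through the half-plane \<open>x < 0\<close>, at the point \<open>(0, y1)\<close>.\<close>

definition left_return :: "real \<Rightarrow> real \<Rightarrow> real \<Rightarrow> real \<Rightarrow> real \<Rightarrow> bool" where
  "left_return T D a y0 y1 \<longleftrightarrow>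
     (\<exists>x y \<tau>. is_solution T D a x y \<and> x 0 = 0 \<and> y 0 = y0 \<and>
        \<tau> > 0 \<and> x \<tau> = 0 \<and> (\<forall>t\<in>{0<..<\<tau>}. x t < 0) \<and> y1 = y \<tau>)"

text \<open>Graph of the left Poincare half-map. The second disjunct is the extension
  by \<open>P(0) = 0\<close>.\<close>

definition left_half_map_graph :: "real \<Rightarrow> real \<Rightarrow> real \<Rightarrow> real \<Rightarrow> real \<Rightarrow> bool" where
  "left_half_map_graph T D a y0 y1 \<longleftrightarrow>
     (y0 \<ge> 0 \<and> left_return T D a y0 y1) \<or>
     (y0 = 0 \<and> y1 = 0 \<and> (\<nexists>z. left_return T D a 0 z) \<and>
        (\<forall>\<epsilon>>0. \<exists>u\<in>{0<..<\<epsilon>}. \<exists>v\<in>{-\<epsilon><..<0}. left_return T D a u v))"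

definition left_half_map_domain :: "real \<Rightarrow> real \<Rightarrow> real \<Rightarrow> real set" where
  "left_half_map_domain T D a = {y0. \<exists>y1. left_half_map_graph T D a y0 y1}"

definition left_half_map :: "real \<Rightarrow> real \<Rightarrow> real \<Rightarrow> real \<Rightarrow> real" where
  "left_half_map T D a y0 = (THE y1. left_half_map_graph T D a y0 y1)"

definition W_poly :: "real \<Rightarrow> real \<Rightarrow> real \<Rightarrow> real \<Rightarrow> real" where
  "W_poly T D a y = D * y\<^sup>2 - a * T * y + a\<^sup>2"

definition real_analytic_at :: "(real \<Rightarrow> real) \<Rightarrow> real \<Rightarrow> bool" where
  "real_analytic_at f c \<longleftrightarrow>
     (\<exists>r>0. \<exists>b. \<forall>x. \<bar>x - c\<bar> < r \<longrightarrow> (\<lambda>n. b n * (x - c) ^ n) sums f x)"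

text \<open>\<open>S\<close> need not be open: at every point of \<open>S\<close>, \<open>f\<close> has to agree on \<open>S\<close> with a function
  that is analytic on a full neighbourhood. At interior points of \<open>S\<close> this is
  ordinary analyticity of \<open>f\<close>.\<close>

definition real_analytic_in :: "(real \<Rightarrow> real) \<Rightarrow> real set \<Rightarrow> bool" where
  "real_analytic_in f S \<longleftrightarrow>
     (\<forall>c\<in>S. \<exists>U g. open U \<and> c \<in> U \<and> (\<forall>u\<in>U. real_analytic_at g u) \<and>
        (\<forall>x\<in>S \<inter> U. f x = g x))"

text \<open>Solutions are determined by their initial values, so the definite description
  in \<open>left_half_map\<close> is proper on the domain.\<close>

lemma is_solution_unique:
  assumes 1: "is_solution T D a x y" and 2: "is_solution T D a x' y'"
    and "x 0 = x' 0" "y 0 = y' 0" and "t \<ge> 0"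
  shows "x t = x' t \<and> y t = y' t"
proof -
  define u where "u = (\<lambda>t. x t - x' t)"
  define v where "v = (\<lambda>t. y t - y' t)"
  define K where "K = 2 * \<bar>T\<bar> + \<bar>D - 1\<bar>"
  define E where "E = (\<lambda>t. ((u t)\<^sup>2 + (v t)\<^sup>2) * exp (- K * t))"
  have du: "(u has_real_derivative T * u t - v t) (at t)" for t
    using 1 2 unfolding is_solution_def u_def v_def
    by (auto intro!: derivative_eq_intros simp: algebra_simps)
  have dv: "(v has_real_derivative D * u t) (at t)" for t
    using 1 2 unfolding is_solution_def u_def v_def
    by (auto intro!: derivative_eq_intros simp: algebra_simps)
  have dE: "(E has_real_derivative
      (2 * T * (u t)\<^sup>2 + 2 * (D - 1) * u t * v t - K * ((u t)\<^sup>2 + (v t)\<^sup>2)) * exp (- K * t)) (at t)" for t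
    unfolding E_def
    by (rule derivative_eq_intros du dv refl)+ (simp add: algebra_simps power2_eq_square)
  have le: "2 * T * (u t)\<^sup>2 + 2 * (D - 1) * u t * v t - K * ((u t)\<^sup>2 + (v t)\<^sup>2) \<le> 0" for t
  proof -
    have "2 * T * (u t)\<^sup>2 \<le> 2 * \<bar>T\<bar> * ((u t)\<^sup>2 + (v t)\<^sup>2)"
    proof -
      have "2 * T * (u t)\<^sup>2 \<le> 2 * \<bar>T\<bar> * (u t)\<^sup>2"
        by (intro mult_right_mono) auto
      also have "\<dots> \<le> 2 * \<bar>T\<bar> * ((u t)\<^sup>2 + (v t)\<^sup>2)"
        by (intro mult_left_mono) auto
      finally show ?thesis .
    qed
    moreover have "2 * (D - 1) * u t * v t \<le> \<bar>D - 1\<bar> * ((u t)\<^sup>2 + (v t)\<^sup>2)"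
    proof -
      have "2 * (D - 1) * u t * v t \<le> \<bar>2 * (D - 1) * u t * v t\<bar>" by simp
      also have "\<dots> = \<bar>D - 1\<bar> * (2 * \<bar>u t\<bar> * \<bar>v t\<bar>)"
        by (simp only: abs_mult abs_numeral mult_ac)
      also have "\<dots> \<le> \<bar>D - 1\<bar> * ((u t)\<^sup>2 + (v t)\<^sup>2)"
        using sum_squares_bound[of "\<bar>u t\<bar>" "\<bar>v t\<bar>"] by (intro mult_left_mono) auto
      finally show ?thesis .
    qed
    ultimately show ?thesis by (simp add: K_def distrib_right)
  qed
  have "E t \<le> E 0"
    by (rule DERIV_nonpos_imp_nonincreasing[OF \<open>t \<ge> 0\<close>])
      (use dE le in \<open>auto intro!: exI mult_nonpos_nonneg\<close>)
  also have "E 0 = 0"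
    using assms by (simp add: E_def u_def v_def)
  finally have "(u t)\<^sup>2 + (v t)\<^sup>2 \<le> 0"
    by (simp add: E_def mult_le_0_iff)
  then have "u t = 0 \<and> v t = 0"
    by (metis sum_power2_le_zero_iff)
  then show ?thesis by (simp add: u_def v_def)
qed

lemma left_return_unique:
  assumes "left_return T D a y0 y1" "left_return T D a y0 z1"
  shows "y1 = z1"
proof -
  obtain x y s where A: "is_solution T D a x y" "x 0 = 0" "y 0 = y0" "s > 0" "x s = 0"
    "\<forall>t\<in>{0<..<s}. x t < 0" "y1 = y s"
    using assms(1) unfolding left_return_def by blast
  obtain x' y' s' where B: "is_solution T D a x' y'" "x' 0 = 0" "y' 0 = y0" "s' > 0" "x' s' = 0"
    "\<forall>t\<in>{0<..<s'}. x' t < 0" "z1 = y' s'"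
    using assms(2) unfolding left_return_def by blast
  have eq: "x t = x' t \<and> y t = y' t" if "t \<ge> 0" for t
    using is_solution_unique[OF A(1) B(1) _ _ that] A B by simp
  have "s = s'"
  proof (rule linorder_cases[of s s'])
    assume "s < s'"
    then have "x' s < 0" using A B by simp
    then show ?thesis using eq[of s] A by simp
  next
    assume "s' < s"
    then have "x s' < 0" using A B by simp
    then show ?thesis using eq[of s'] B by simp
  qed
  then show ?thesis using eq[of s] A B by simp
qed

lemma left_half_map_eqI:
  assumes "left_half_map_graph T D a y0 y1"
  shows "left_half_map T D a y0 = y1"
  unfolding left_half_map_def
proof (rule the_equality[where P = "left_half_map_graph T D a y0"])
  show "left_half_map_graph T D a y0 y1" by (rule assms)
  show "z = y1" if "left_half_map_graph T D a y0 z" for z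
    using that assms left_return_unique unfolding left_half_map_graph_def by metis
qed

end

(*
  For a < 0 and complex eigenvalues, time is rescaled to t = w * time so that the orbit
  starting at (0, y0) meets the section again at time t iff y0 = h(t), where
  h(t) = A (exp(-b t) - cos t + b sin t) / sin t. By time reversal it arrives at h(-t).
  On (pi, 2 pi) the function h is a decreasing bijection onto the reals whose derivative is
  - exp(-b t) h(-t) / sin t, so P(h(t)) = h(-t) there, and the complex inverse function theorem
  makes P analytic, even beyond the endpoint 0. Since W(h(-t)) = exp(2 b t) W(h(t)),
  the map satisfies W(y) P(y) P'(y) = y W(P(y)); comparing coefficients in this equation
  gives the Taylor expansion, and its sign gives monotonicity.
  The conditions on a, T and D are forced by the return of the orbit through the origin.
*)

theory Submission
  imports Defs "HOL-Complex_Analysis.Complex_Analysis"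
begin

section \<open>Return points in terms of the return time\<close>

text \<open>In the application the eigenvalues are \<open>w * (b + i)\<close> and
  \<open>w * (b - i)\<close>, and \<open>A = a * w / D\<close>. The type is left polymorphic so that
  one formula serves the real return times and their complex extension.\<close>

definition section_ordinate :: "real \<Rightarrow> real \<Rightarrow> 'a::{banach, real_normed_field} \<Rightarrow> 'a" where
  "section_ordinate A b z =
     of_real A * (exp (- of_real b * z) - cos z + of_real b * sin z) / sin z"

lemma section_ordinate_of_real:
  "section_ordinate A b (of_real t) = (of_real (section_ordinate A b t) :: 'a::{banach, real_normed_field})"
  by (simp add: section_ordinate_def flip: exp_of_real cos_of_real sin_of_real)

lemma section_ordinate_uminus_of_real:
  "section_ordinate A b (- of_real t) = (of_real (section_ordinate A b (- t)) :: 'a::{banach, real_normed_field})"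
  using section_ordinate_of_real[of A b "- t"] by simp

lemma section_ordinate_mult_sin:
  "sin z \<noteq> 0 \<Longrightarrow>
    section_ordinate A b z * sin z = of_real A * (exp (- of_real b * z) - cos z + of_real b * sin z)"
  by (simp add: section_ordinate_def)

lemma section_ordinate_uminus_mult_sin:
  "sin z \<noteq> 0 \<Longrightarrow>
    section_ordinate A b (- z) * sin z = of_real A * (cos z + of_real b * sin z - exp (of_real b * z))"
  by (simp add: section_ordinate_def field_simps)

text \<open>In the numerator of the quotient rule, the Pythagorean identity and
  \<open>exp (- b * z) * exp (b * z) = 1\<close> bring out the same function at \<open>- z\<close>.
  Over the reals, the sign of the arrival ordinate thus controls the monotonicity of the starting
  ordinate.\<close>

lemma has_field_derivative_section_ordinate:
  fixes z :: "'a::{banach, real_normed_field}"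
  assumes "sin z \<noteq> 0"
  shows "(section_ordinate A b has_field_derivative
           - exp (- of_real b * z) * section_ordinate A b (- z) / sin z) (at z)"
proof -
  have e: "exp (- (of_real b * z)) * exp (of_real b * z) = 1"
    by (simp flip: exp_add)
  have sc: "cos z * cos z = 1 - sin z * sin z"
    using sin_cos_squared_add3[of z] by (simp add: algebra_simps power2_eq_square)
  have "(section_ordinate A b has_field_derivative
      of_real A * ((- of_real b * exp (- of_real b * z) + sin z + of_real b * cos z) * sin z
        - (exp (- of_real b * z) - cos z + of_real b * sin z) * cos z) / (sin z * sin z)) (at z)"
    unfolding section_ordinate_def
    by (rule derivative_eq_intros refl assms)+ (simp add: mult.commute mult.left_commute right_diff_distrib)
  also have "of_real A * ((- of_real b * exp (- of_real b * z) + sin z + of_real b * cos z) * sin z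
        - (exp (- of_real b * z) - cos z + of_real b * sin z) * cos z) / (sin z * sin z) =
      - exp (- of_real b * z) * (section_ordinate A b (- z) * sin z) / (sin z * sin z)"
  proof -
    have "(- of_real b * exp (- of_real b * z) + sin z + of_real b * cos z) * sin z
        - (exp (- of_real b * z) - cos z + of_real b * sin z) * cos z =
      1 - exp (- of_real b * z) * (cos z + of_real b * sin z)"
      using sc by (simp add: algebra_simps)
    also have "\<dots> = - exp (- of_real b * z) * (cos z + of_real b * sin z - exp (of_real b * z))"
      using e by (simp add: algebra_simps)
    finally show ?thesis
      unfolding section_ordinate_uminus_mult_sin[OF assms] by simp
  qed
  finally show ?thesis using assms by simp
qed

lemma has_field_derivative_section_ordinate_uminus:
  fixes z :: "'a::{banach, real_normed_field}"
  assumes "sin z \<noteq> 0"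
  shows "((\<lambda>z. section_ordinate A b (- z)) has_field_derivative
           - exp (of_real b * z) * section_ordinate A b z / sin z) (at z)"
proof -
  have "((\<lambda>z. section_ordinate A b (- z)) has_field_derivative
      (- exp (- of_real b * (- z)) * section_ordinate A b (- (- z)) / sin (- z)) * (- 1)) (at z)"
    by (rule DERIV_chain2[OF has_field_derivative_section_ordinate])
      (use assms in \<open>auto intro!: derivative_eq_intros\<close>)
  then show ?thesis by simp
qed

section \<open>Signs, monotonicity and range of the ordinate on \<open>(0, pi)\<close> and
  \<open>(pi, 2 * pi)\<close>\<close>

text \<open>The function equals 1 at 0, and its derivative
  \<open>- (1 + c\<^sup>2) * exp (c * t) * sin t\<close> is negative on
  \<open>(0, pi)\<close>.\<close>

lemma exp_spiral_less_1:
  fixes c t :: real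
  assumes "0 < t" "t \<le> pi"
  shows "exp (c * t) * (cos t - c * sin t) < 1"
proof -
  have "exp (c * t) * (cos t - c * sin t) < exp (c * 0) * (cos 0 - c * sin 0)"
  proof (rule DERIV_neg_imp_decreasing_open[OF \<open>0 < t\<close>])
    fix u assume u: "0 < u" "u < t"
    have "((\<lambda>t. exp (c * t) * (cos t - c * sin t)) has_real_derivative
        - (1 + c\<^sup>2) * exp (c * u) * sin u) (at u)"
      by (rule derivative_eq_intros refl)+ (simp add: algebra_simps power2_eq_square)
    moreover have "0 < sin u" using u assms by (intro sin_gt_zero) auto
    then have "- (1 + c\<^sup>2) * exp (c * u) * sin u < 0"
      using sum_power2_gt_zero_iff[of 1 c] by (intro mult_neg_pos) auto
    ultimately show "\<exists>y. ((\<lambda>t. exp (c * t) * (cos t - c * sin t)) has_real_derivative y) (at u) \<and> y < 0"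
      by blast
  qed (intro continuous_intros)
  then show ?thesis by simp
qed

lemma sin_neg_pi_2pi: "pi < t \<Longrightarrow> t < 2 * pi \<Longrightarrow> sin t < 0"
  using sin_gt_zero[of "t - pi"] by (simp add: sin_diff)

text \<open>Past \<open>pi\<close> the sine is negative, so the function increases towards its value
  \<open>exp (- b * (2 * pi))\<close> at \<open>2 * pi\<close>, which lies below 1 because
  \<open>b > 0\<close>.\<close>

lemma exp_spiral_less_1':
  fixes b t :: real
  assumes "b > 0" "pi < t" "t < 2 * pi"
  shows "exp (- b * t) * (cos t + b * sin t) < 1"
proof -
  have "exp (- b * t) * (cos t + b * sin t) < exp (- b * (2 * pi)) * (cos (2 * pi) + b * sin (2 * pi))"
  proof (rule DERIV_pos_imp_increasing_open[OF \<open>t < 2 * pi\<close>])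
    fix u assume u: "t < u" "u < 2 * pi"
    have "((\<lambda>t. exp (- b * t) * (cos t + b * sin t)) has_real_derivative
        - (1 + b\<^sup>2) * exp (- b * u) * sin u) (at u)"
      by (rule derivative_eq_intros refl)+ (simp add: algebra_simps power2_eq_square)
    moreover have "sin u < 0" using u assms by (intro sin_neg_pi_2pi) auto
    then have "- (1 + b\<^sup>2) * exp (- b * u) * sin u > 0"
      using sum_power2_gt_zero_iff[of 1 b] by (intro mult_neg_neg mult_neg_pos) auto
    ultimately show "\<exists>y. ((\<lambda>t. exp (- b * t) * (cos t + b * sin t)) has_real_derivative y) (at u) \<and> y > 0"
      by blast
  qed (intro continuous_intros)
  also have "\<dots> < 1" using assms by simp
  finally show ?thesis .
qed

lemma section_ordinate_neg:
  fixes t :: real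
  assumes "A < 0" "0 < t" "t < pi"
  shows "section_ordinate A b t < 0"
proof -
  have s: "0 < sin t" using assms by (intro sin_gt_zero) auto
  have "exp (- b * t) * (exp (b * t) * (cos t - b * sin t)) < exp (- b * t) * 1"
    by (intro mult_strict_left_mono exp_spiral_less_1) (use assms in auto)
  then have "0 < exp (- b * t) - cos t + b * sin t"
    by (simp flip: exp_add mult.assoc)
  then show ?thesis
    using s assms by (auto simp: section_ordinate_def divide_less_0_iff mult_less_0_iff)
qed

text \<open>The spiral bound, multiplied by \<open>exp (b * t)\<close>, makes the bracket in the
  numerator negative; \<open>A\<close> and \<open>sin t\<close> are negative as well.\<close>

lemma section_ordinate_uminus_neg:
  fixes t :: real
  assumes "A < 0" "b > 0" "pi < t" "t < 2 * pi"
  shows "section_ordinate A b (- t) < 0"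
proof -
  have s: "sin t < 0" using assms by (intro sin_neg_pi_2pi) auto
  have "exp (b * t) * (exp (- b * t) * (cos t + b * sin t)) < exp (b * t) * 1"
    by (intro mult_strict_left_mono exp_spiral_less_1') (use assms in auto)
  then have "cos t + b * sin t - exp (b * t) < 0"
    by (simp flip: exp_add mult.assoc)
  then have "0 < A * (cos t + b * sin t - exp (b * t))"
    using assms by (intro mult_neg_neg)
  then show ?thesis
    using section_ordinate_uminus_mult_sin[of t A b] s
      zero_less_mult_iff[of "section_ordinate A b (- t)" "sin t"] by simp
qed

text \<open>In the derivative formula both \<open>sin u\<close> and the ordinate at
  \<open>- u\<close> are negative here, which leaves a negative slope.\<close>

lemma section_ordinate_strict_antimono:
  fixes s t :: real
  assumes "A < 0" "b > 0" "pi < s" "s < t" "t < 2 * pi"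
  shows "section_ordinate A b t < section_ordinate A b s"
proof (rule DERIV_neg_imp_decreasing[OF \<open>s < t\<close>])
  fix u assume "s \<le> u" "u \<le> t"
  then have u: "pi < u" "u < 2 * pi" using assms by auto
  have "sin u < 0" by (rule sin_neg_pi_2pi[OF u])
  moreover have "section_ordinate A b (- u) < 0"
    by (rule section_ordinate_uminus_neg) (use assms u in auto)
  ultimately have "- exp (- of_real b * u) * section_ordinate A b (- u) / sin u < 0"
    by (intro divide_pos_neg mult_neg_neg) auto
  then show "\<exists>y. (section_ordinate A b has_real_derivative y) (at u) \<and> y < 0"
    using has_field_derivative_section_ordinate[of u A b] \<open>sin u < 0\<close> by (metis less_irrefl)
qed

lemma section_ordinate_surj:
  fixes y :: real
  assumes "A < 0" "b > 0"
  obtains t where "pi < t" "t < 2 * pi" "section_ordinate A b t = y"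
proof -
  \<comment> \<open>Multiplying the equation by \<open>sin t\<close> removes the poles at
    \<open>pi\<close> and \<open>2 * pi\<close>. There \<open>G\<close> takes the values
    \<open>A * (exp (- b * pi) + 1)\<close> and \<open>A * (exp (- b * (2 * pi)) - 1)\<close>, which
    have opposite signs.\<close>
  define G where "G t = A * (exp (- b * t) - cos t + b * sin t) - y * sin t" for t
  have 0: "G pi < 0"
    using assms by (auto simp: G_def intro!: mult_neg_pos add_pos_pos)
  have 1: "G (2 * pi) > 0"
    using assms by (auto simp: G_def intro!: mult_neg_neg)
  have "continuous_on {pi..2*pi} G"
    unfolding G_def by (intro continuous_intros)
  then obtain t where t: "pi \<le> t" "t \<le> 2 * pi" "G t = 0"
    using IVT'[of G pi 0 "2 * pi"] 0 1 by force
  then have "pi < t" "t < 2 * pi" using 0 1 by (auto simp: less_le)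
  moreover from this have "sin t < 0" by (rule sin_neg_pi_2pi)
  then have "section_ordinate A b t = y"
    using t by (simp add: section_ordinate_def G_def field_simps)
  ultimately show ?thesis using that by blast
qed

section \<open>Analytic functions on the real line\<close>

text \<open>At real points the powers of \<open>x - c\<close> are real, so taking real parts of the
  complex Taylor coefficients yields a real power series.\<close>

lemma real_analytic_at_of_holomorphic:
  assumes "r > 0" and G: "G holomorphic_on ball (complex_of_real c) r"
    and f: "\<And>x. \<bar>x - c\<bar> < r \<Longrightarrow> f x = Re (G (of_real x))"
  shows "real_analytic_at f c"
  unfolding real_analytic_at_def
proof (intro exI conjI allI impI)
  show "r > 0" by fact
  fix x assume x: "\<bar>x - c\<bar> < r"
  have "complex_of_real x \<in> ball (of_real c) r"
    using x by (simp add: dist_norm abs_minus_commute flip: of_real_diff)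
  from holomorphic_power_series[OF G this]
  have "(\<lambda>n. Re ((deriv ^^ n) G (of_real c) / fact n * of_real ((x - c) ^ n))) sums Re (G (of_real x))"
    by (intro sums_Re) simp
  then show "(\<lambda>n. Re ((deriv ^^ n) G (of_real c) / fact n) * (x - c) ^ n) sums f x"
    using f[OF x] by (simp only: Re_complex_of_real times_complex.sel Im_complex_of_real mult_zero_right diff_zero)
qed

text \<open>Near \<open>h c\<close> the function \<open>f\<close> is the restriction of
  \<open>K\<close> composed with the local holomorphic inverse of \<open>H\<close>. This treats a
  curve given as \<open>(h x, k x)\<close> as an analytic graph.\<close>

lemma real_analytic_at_parametric:
  fixes h k f :: "real \<Rightarrow> real" and S :: "complex set"
  assumes H: "H holomorphic_on S" and K: "K holomorphic_on S"
    and S: "open S" "of_real c \<in> S" and H': "deriv H (of_real c) \<noteq> 0"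
    and Hh: "\<And>x. of_real x \<in> S \<Longrightarrow> H (of_real x) = of_real (h x)"
    and Kk: "\<And>x. of_real x \<in> S \<Longrightarrow> K (of_real x) = of_real (k x)"
    and f: "\<And>x. of_real x \<in> S \<Longrightarrow> f (h x) = k x"
  shows "real_analytic_at f (h c)"
proof -
  obtain r where r: "r > 0" "ball (of_real c) r \<subseteq> S" "inj_on H (ball (of_real c) r)"
    by (rule has_complex_derivative_locally_injective[OF H S(2,1) H'])
  define B where "B = ball (complex_of_real c) r"
  define J where "J = ball c r"
  have JB: "of_real x \<in> B" if "x \<in> J" for x
    using that by (simp add: B_def J_def dist_of_real)
  have HB: "H holomorphic_on B" and KB: "K holomorphic_on B"
    using H K r(2) by (auto simp: B_def intro: holomorphic_on_subset)
  obtain g where g: "g holomorphic_on H ` B" "\<And>z. z \<in> B \<Longrightarrow> g (H z) = z"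
    by (rule holomorphic_has_inverse[OF HB]) (use r in \<open>auto simp: B_def\<close>)
  have "open (H ` B)"
    by (rule open_mapping_thm3[OF HB]) (use r in \<open>auto simp: B_def\<close>)
  have hJ: "H (of_real x) = of_real (h x)" if "x \<in> J" for x
    using JB[OF that] r(2) by (intro Hh) (auto simp: B_def)
  have "continuous_on J (\<lambda>x. Re (H (of_real x)))"
    using JB by (intro continuous_intros continuous_on_compose2[OF holomorphic_on_imp_continuous_on[OF HB]]) auto
  then have "continuous_on J h"
    by (rule continuous_on_eq) (simp add: hJ)
  moreover have "inj_on h J"
  proof (rule inj_onI)
    fix x y assume xy: "x \<in> J" "y \<in> J" "h x = h y"
    then have "H (of_real x) = H (of_real y)" by (simp add: hJ)
    then show "x = y" using g(2)[OF JB[OF xy(1)]] g(2)[OF JB[OF xy(2)]] by (metis of_real_eq_iff)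
  qed
  ultimately have "open (h ` J)"
    by (intro invariance_of_domain) (auto simp: J_def)
  moreover have c: "c \<in> J" using r by (simp add: J_def)
  ultimately obtain d1 where d1: "d1 > 0" "ball (h c) d1 \<subseteq> h ` J"
    by (meson image_eqI openE)
  have "of_real (h c) \<in> H ` B" using hJ[OF c] JB[OF c] by (metis image_eqI)
  then obtain d2 where d2: "d2 > 0" "ball (of_real (h c)) d2 \<subseteq> H ` B"
    using \<open>open (H ` B)\<close> by (meson openE)
  define d where "d = min d1 d2"
  show ?thesis
  proof (rule real_analytic_at_of_holomorphic)
    show "d > 0" using d1 d2 by (simp add: d_def)
    have "K \<circ> g holomorphic_on H ` B"
      by (rule holomorphic_on_compose_gen[OF g(1) KB]) (use g(2) in auto)
    then show "K \<circ> g holomorphic_on ball (of_real (h c)) d"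
      by (rule holomorphic_on_subset) (use d2 in \<open>auto simp: d_def\<close>)
    fix y assume "\<bar>y - h c\<bar> < d"
    then have "y \<in> ball (h c) d1" by (simp add: d_def dist_real_def abs_minus_commute)
    then obtain x where x: "x \<in> J" "y = h x" using d1(2) by blast
    have xS: "of_real x \<in> S" using JB[OF x(1)] r(2) by (auto simp: B_def)
    have "(K \<circ> g) (of_real y) = K (of_real x)"
      using g(2)[OF JB[OF x(1)]] hJ[OF x(1)] x by simp
    then show "f y = Re ((K \<circ> g) (of_real y))"
      using Kk[OF xS] f[OF xS] x by simp
  qed
qed

section \<open>Power series at 0, derivatives and Taylor remainders\<close>

lemma real_analytic_at_imp_has_fps_expansion_0:
  assumes "real_analytic_at f 0"
  obtains F where "f has_fps_expansion F"
proof -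
  obtain r b where r: "r > 0" "\<And>x. \<bar>x\<bar> < r \<Longrightarrow> (\<lambda>n. b n * x ^ n) sums f x"
    using assms by (auto simp: real_analytic_at_def)
  have "f has_fps_expansion Abs_fps b"
    by (rule has_fps_expansionI) (use r in \<open>auto simp: eventually_nhds_metric dist_real_def\<close>)
  then show ?thesis by (rule that)
qed

lemma real_analytic_at_imp_differentiable:
  assumes "real_analytic_at f c"
  shows "f field_differentiable (at c)"
proof -
  obtain r b where r: "r > 0" "\<And>x. \<bar>x - c\<bar> < r \<Longrightarrow> (\<lambda>n. b n * (x - c) ^ n) sums f x"
    using assms by (auto simp: real_analytic_at_def)
  have sums: "(\<lambda>n. b n * z ^ n) sums f (z + c)" if "norm z < r" for z
    using r(2)[of "z + c"] that by simp
  obtain D where "((\<lambda>z. \<Sum>n. b n * z ^ n) has_field_derivative D) (at 0)"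
    using termdiffs_strong'[of r b 0] sums r(1) by (auto simp: sums_iff)
  then have "((\<lambda>z. f (z + c)) has_field_derivative D) (at 0)"
  proof (rule has_field_derivative_transform_within[OF _ r(1)])
    show "(\<Sum>n. b n * z ^ n) = f (z + c)" if "dist z 0 < r" for z
      using sums[of z] that by (simp add: sums_iff)
  qed auto
  then have "(f has_field_derivative D) (at c)"
    by (subst (asm) DERIV_shift[symmetric]) simp
  then show ?thesis by (auto simp: field_differentiable_def)
qed

text \<open>Otherwise, dividing \<open>f x\<close> by \<open>x ^ n\<close> with \<open>n\<close> the
  subdegree gives a function that is continuous at 0 with nonzero value there, yet vanishes at all
  nearby \<open>x \<noteq> 0\<close>.\<close>

lemma has_fps_expansion_real_eq_0:
  fixes F :: "real fps"
  assumes F: "f has_fps_expansion F" and "eventually (\<lambda>x. f x = 0) (nhds 0)"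
  shows "F = 0"
proof (rule ccontr)
  assume "F \<noteq> 0"
  define n where "n = subdegree F"
  define q where "q x = (if x = 0 then fps_nth F n else f x / x ^ n)" for x
  have "q has_fps_expansion fps_shift n F"
    unfolding q_def by (rule has_fps_expansion_shift[OF F _ refl]) (simp add: n_def)
  then have "continuous (at 0) q" by (rule has_fps_expansion_imp_continuous)
  then have "(q \<longlongrightarrow> q 0) (at 0)" by (simp add: continuous_within)
  moreover have "eventually (\<lambda>x. q x = 0) (at 0)"
    using assms(2) by (auto simp: q_def eventually_at_filter elim: eventually_mono)
  then have "(q \<longlongrightarrow> 0) (at 0)" by (rule tendsto_eventually)
  ultimately have "q 0 = 0" by (intro tendsto_unique[of "at 0" q]) auto
  then show False using \<open>F \<noteq> 0\<close> by (simp add: q_def n_def)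
qed

lemma has_fps_expansion_taylor_bigo:
  fixes F :: "real fps"
  assumes F: "f has_fps_expansion F"
  shows "(\<lambda>x. f x - (\<Sum>k<n. fps_nth F k * x ^ k)) \<in> O[at_right 0](\<lambda>x. x ^ n)"
proof -
  define R where "R = F - (\<Sum>k<n. fps_const (fps_nth F k) * fps_X ^ k)"
  define g where "g x = f x - (\<Sum>k<n. fps_nth F k * x ^ k)" for x
  have g: "g has_fps_expansion R"
    unfolding R_def g_def by (intro fps_expansion_intros F)
  have R0: "fps_nth R k = 0" if "k < n" for k
    using that by (simp add: R_def fps_sum_nth fps_X_power_nth if_distrib sum.delta cong: if_cong)
  \<comment> \<open>The zero series is separate because its subdegree is 0 by convention. Otherwise
    \<open>x ^ n\<close> divides the remainder series, and the quotient has a limit at 0.\<close>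
  show ?thesis
  proof (cases "R = 0")
    case True
    then have "eventually (\<lambda>x. g x = 0) (nhds 0)"
      using g by (simp add: has_fps_expansion_0_iff)
    then have "eventually (\<lambda>x. g x = 0) (at_right 0)"
      by (auto simp: eventually_at_filter elim: eventually_mono)
    then have "g \<in> O[at_right 0](\<lambda>x. x ^ n)"
      by (intro landau_o.bigI[of 1]) (auto elim: eventually_mono)
    then show ?thesis by (simp add: g_def[abs_def])
  next
    case False
    then have n: "n \<le> subdegree R" using R0 by (intro subdegree_geI) auto
    define q where "q x = (if x = 0 then fps_nth R n else g x / x ^ n)" for x
    have "q has_fps_expansion fps_shift n R"
      unfolding q_def by (rule has_fps_expansion_shift[OF g n refl])
    then have "continuous (at_right 0) q" by (rule has_fps_expansion_imp_continuous)
    then have "(q \<longlongrightarrow> q 0) (at_right 0)" by (simp add: continuous_within)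
    then have "((\<lambda>x. g x / x ^ n) \<longlongrightarrow> q 0) (at_right 0)"
      by (rule Lim_transform_eventually) (auto simp: q_def eventually_at_filter)
    then have "g \<in> O[at_right 0](\<lambda>x. x ^ n)"
    proof (rule bigoI_tendsto)
      show "eventually (\<lambda>x::real. x ^ n \<noteq> 0) (at_right 0)"
        using eventually_at_right_less[of "0::real"] by (rule eventually_mono) simp
    qed
    then show ?thesis by (simp add: g_def[abs_def])
  qed
qed

section \<open>Analyticity and the differential equation of the half-map\<close>

text \<open>The description inverts the ordinate on \<open>(pi, 2 * pi)\<close>, which is a
  bijection onto the reals when \<open>A < 0\<close> and \<open>b > 0\<close>. Negative
  \<open>y\<close> are included, which later provides a full neighbourhood of the endpoint
  0.\<close>

definition left_return_ordinate :: "real \<Rightarrow> real \<Rightarrow> real \<Rightarrow> real" where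
  "left_return_ordinate A b y =
     section_ordinate A b (- (THE t. pi < t \<and> t < 2 * pi \<and> section_ordinate A b t = y))"

lemma left_return_ordinate_section_ordinate:
  assumes "A < 0" "b > 0" "pi < t" "t < 2 * pi"
  shows "left_return_ordinate A b (section_ordinate A b t) = section_ordinate A b (- t)"
proof -
  have "(THE s. pi < s \<and> s < 2 * pi \<and> section_ordinate A b s = section_ordinate A b t) = t"
  proof (rule the_equality)
    fix s assume s: "pi < s \<and> s < 2 * pi \<and> section_ordinate A b s = section_ordinate A b t"
    then show "s = t"
      using section_ordinate_strict_antimono[of A b s t] section_ordinate_strict_antimono[of A b t s] assms
      by (cases s t rule: linorder_cases) auto
  qed (use assms in auto)
  then show ?thesis by (simp add: left_return_ordinate_def)
qed

lemma real_analytic_at_left_return_ordinate: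
  assumes "A < 0" "b > 0"
  shows "real_analytic_at (left_return_ordinate A b) y"
proof -
  obtain t where t: "pi < t" "t < 2 * pi" "section_ordinate A b t = y"
    by (rule section_ordinate_surj[OF assms])
  \<comment> \<open>In this vertical strip the complex sine has no zeros, since all of them are
    integer multiples of \<open>pi\<close>. Both ordinate functions are therefore holomorphic on
    it.\<close>
  define S where "S = {z. pi < Re z \<and> Re z < 2 * pi}"
  have sin: "sin z \<noteq> 0" if "z \<in> S" for z
  proof
    assume "sin z = 0"
    then obtain n :: int where n: "z = of_real (n * pi)" by (auto simp: sin_eq_0)
    then have "1 < real_of_int n" "real_of_int n < 2" using that by (auto simp: S_def)
    then have "1 < n" "n < 2" by simp_all
    then show False by linarith
  qed
  have "open S"
    unfolding S_def by (intro open_Collect_conj open_halfspace_Re_gt open_halfspace_Re_lt)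
  have mem: "of_real x \<in> S \<longleftrightarrow> pi < x \<and> x < 2 * pi" for x
    by (simp add: S_def)
  have "real_analytic_at (left_return_ordinate A b) (section_ordinate A b t)"
  proof (rule real_analytic_at_parametric[where H = "section_ordinate A b" and c = t
        and K = "\<lambda>z. section_ordinate A b (- z)" and k = "\<lambda>t. section_ordinate A b (- t)"])
    show "section_ordinate A b holomorphic_on S"
      using has_field_derivative_section_ordinate sin \<open>open S\<close>
      by (subst holomorphic_on_open) blast+
    show "(\<lambda>z. section_ordinate A b (- z)) holomorphic_on S"
      using has_field_derivative_section_ordinate_uminus sin \<open>open S\<close>
      by (subst holomorphic_on_open) blast+
    show "open S" by fact
    show tS: "of_real t \<in> S" using t by (simp add: mem)
    have "section_ordinate A b (- t) \<noteq> 0"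
      using section_ordinate_uminus_neg[of A b t] assms t by simp
    then show "deriv (section_ordinate A b) (complex_of_real t) \<noteq> 0"
      using DERIV_imp_deriv[OF has_field_derivative_section_ordinate[OF sin[OF tS], of A b]] sin[OF tS]
      by (simp add: section_ordinate_uminus_of_real)
  qed (use assms in \<open>simp_all add: mem section_ordinate_of_real section_ordinate_uminus_of_real
         left_return_ordinate_section_ordinate\<close>)
  then show ?thesis by (simp add: t)
qed

text \<open>Completing the square gives \<open>W(y) = D * ((y - A * b)\<^sup>2 + A\<^sup>2)\<close>.
  Times \<open>(sin t)\<^sup>2\<close>, the values at the two ordinates become
  \<open>c * (E\<^sup>2 - 2 * E * cos t + 1)\<close> and the same expression in
  \<open>1 / E\<close>, whose ratio is \<open>E\<^sup>2\<close>.\<close>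

lemma W_poly_section_ordinate_uminus:
  fixes t w A b :: real
  assumes "sin t \<noteq> 0" "T = 2 * b * w" "D = w\<^sup>2 * (1 + b\<^sup>2)" "a = A * w * (1 + b\<^sup>2)"
  shows "W_poly T D a (section_ordinate A b (- t)) = exp (2 * b * t) * W_poly T D a (section_ordinate A b t)"
proof -
  define E where "E = exp (b * t)"
  define E' where "E' = exp (- b * t)"
  have EE: "E * E' = 1" by (simp add: E_def E'_def flip: exp_add)
  have sc: "(cos t)\<^sup>2 = 1 - (sin t)\<^sup>2" by (rule cos_squared_eq)
  define u where "u = section_ordinate A b t"
  define v where "v = section_ordinate A b (- t)"
  have u: "u * sin t = A * (E' - cos t + b * sin t)"
    using section_ordinate_mult_sin[of t A b] assms(1) by (simp add: u_def E'_def)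
  have v: "v * sin t = A * (cos t + b * sin t - E)"
    using section_ordinate_uminus_mult_sin[of t A b] assms(1) by (simp add: v_def E_def)
  define c where "c = A\<^sup>2 * w\<^sup>2 * (1 + b\<^sup>2)"
  have W: "W_poly T D a y * (sin t)\<^sup>2 =
      w\<^sup>2 * (1 + b\<^sup>2) * ((y * sin t - A * b * sin t)\<^sup>2 + A\<^sup>2 * (sin t)\<^sup>2)" for y
    unfolding W_poly_def assms by algebra
  have "W_poly T D a v * (sin t)\<^sup>2 = c * (E\<^sup>2 - 2 * E * cos t + 1)"
    unfolding W v c_def using sc by algebra
  moreover have "W_poly T D a u * (sin t)\<^sup>2 = c * (E'\<^sup>2 - 2 * E' * cos t + 1)"
    unfolding W u c_def using sc by algebra
  moreover have "exp (2 * b * t) = E\<^sup>2"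
    by (simp add: E_def power2_eq_square flip: exp_add)
  ultimately have "W_poly T D a v * (sin t)\<^sup>2 = exp (2 * b * t) * W_poly T D a u * (sin t)\<^sup>2"
    using EE by algebra
  then show ?thesis using assms(1) by (simp add: u_def v_def)
qed

text \<open>Differentiating the parametric identity for \<open>P\<close> in two ways gives
  \<open>P y * deriv P y = exp (2 * b * t) * y\<close>. The exponential is the ratio of the two
  values of \<open>W_poly\<close>, so the return time drops out.\<close>

lemma left_return_ordinate_ode:
  fixes A b w y :: real
  assumes "A < 0" "b > 0" "T = 2 * b * w" "D = w\<^sup>2 * (1 + b\<^sup>2)" "a = A * w * (1 + b\<^sup>2)"
  defines "P \<equiv> left_return_ordinate A b"
  shows "W_poly T D a y * (P y * deriv P y) = y * W_poly T D a (P y)"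
proof -
  obtain t where t: "pi < t" "t < 2 * pi" "section_ordinate A b t = y"
    by (rule section_ordinate_surj[OF assms(1,2)])
  have s: "sin t < 0" using t by (intro sin_neg_pi_2pi) auto
  define v where "v = section_ordinate A b (- t)"
  have v: "v < 0" unfolding v_def using assms t by (intro section_ordinate_uminus_neg) auto
  have Py: "P y = v"
    using left_return_ordinate_section_ordinate[of A b t] assms t by (simp add: P_def v_def)
  have "(P has_real_derivative deriv P y) (at (section_ordinate A b t))"
    using real_analytic_at_imp_differentiable[OF real_analytic_at_left_return_ordinate[OF assms(1,2), of y]]
    by (simp add: field_differentiable_derivI P_def t)
  from DERIV_chain2[OF this has_field_derivative_section_ordinate]
  have "((\<lambda>t. P (section_ordinate A b t)) has_real_derivative
      deriv P y * (- exp (- b * t) * v / sin t)) (at t)"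
    using s by (simp add: v_def)
  then have "((\<lambda>t. section_ordinate A b (- t)) has_real_derivative
      deriv P y * (- exp (- b * t) * v / sin t)) (at t)"
  proof (rule has_field_derivative_transform_within_open)
    show "P (section_ordinate A b x) = section_ordinate A b (- x)" if "x \<in> {pi<..<2 * pi}" for x
      using that assms by (simp add: left_return_ordinate_section_ordinate)
  qed (use t in auto)
  moreover have "((\<lambda>t. section_ordinate A b (- t)) has_real_derivative - exp (b * t) * y / sin t) (at t)"
    using has_field_derivative_section_ordinate_uminus[of t A b] s t by simp
  ultimately have "deriv P y * (- exp (- b * t) * v / sin t) = - exp (b * t) * y / sin t"
    by (rule DERIV_unique)
  then have "deriv P y * (exp (- b * t) * v) = exp (b * t) * y"
    using s by simp
  moreover have "exp (b * t) * exp (- b * t) = 1" "exp (2 * b * t) = exp (b * t) * exp (b * t)"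
    by (simp_all flip: exp_add)
  ultimately have "v * deriv P y = exp (2 * b * t) * y" by algebra
  moreover have "W_poly T D a v = exp (2 * b * t) * W_poly T D a y"
    using W_poly_section_ordinate_uminus[of t T b w D a A] s assms t by (simp add: v_def)
  ultimately show ?thesis by (simp add: Py)
qed

section \<open>Orbits of the planar system\<close>

text \<open>Here \<open>v\<close> is the derivative of \<open>x\<close>, so the first equation
  dictates \<open>y = T * x - v\<close>, and the second becomes
  \<open>x'' = T * x' - D * x + a\<close>.\<close>

lemma is_solution_focus:
  fixes A b w y0 :: real
  assumes "w \<noteq> 0" "T = 2 * b * w" "D = w\<^sup>2 * (1 + b\<^sup>2)" "a = A * w * (1 + b\<^sup>2)"
  defines "x \<equiv> \<lambda>t. (A * (1 - exp (b * (w * t)) * (cos (w * t) - b * sin (w * t)))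
                 - y0 * exp (b * (w * t)) * sin (w * t)) / w"
    and "v \<equiv> \<lambda>t. A * (1 + b\<^sup>2) * exp (b * (w * t)) * sin (w * t)
                 - y0 * exp (b * (w * t)) * (b * sin (w * t) + cos (w * t))"
  shows "is_solution T D a x (\<lambda>t. T * x t - v t)"
proof -
  define N where "N t = A * (1 - exp (b * (w * t)) * (cos (w * t) - b * sin (w * t)))
                 - y0 * exp (b * (w * t)) * sin (w * t)" for t
  have N: "(N has_real_derivative w * v t) (at t)" for t
    unfolding N_def v_def
    by (rule derivative_eq_intros refl)+ (simp add: algebra_simps power2_eq_square)
  have x_eq: "x = (\<lambda>t. N t / w)" by (simp add: x_def N_def)
  have x: "(x has_real_derivative v t) (at t)" for t
    using DERIV_cdivide[OF N, of w] assms(1) by (simp add: x_eq)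
  have Dx: "D * x t = w * (1 + b\<^sup>2) * N t" for t
    using assms(1) by (simp add: x_eq assms power2_eq_square)
  have v: "(v has_real_derivative T * v t - D * x t + a) (at t)" for t
    unfolding v_def
    by (rule derivative_eq_intros refl)+ (simp add: Dx, simp add: N_def assms algebra_simps power2_eq_square)
  show ?thesis
    unfolding is_solution_def
    by (auto intro!: derivative_eq_intros x v)
qed

lemma left_return_section_ordinate:
  fixes A b w t :: real
  assumes "w > 0" "A < 0" "b > 0" and p: "T = 2 * b * w" "D = w\<^sup>2 * (1 + b\<^sup>2)" "a = A * w * (1 + b\<^sup>2)"
    and t: "pi < t" "t < 2 * pi" and y0: "section_ordinate A b t \<ge> 0"
  shows "left_return T D a (section_ordinate A b t) (section_ordinate A b (- t))"
proof -
  define y0 where "y0 = section_ordinate A b t"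
  define x where "x t = (A * (1 - exp (b * (w * t)) * (cos (w * t) - b * sin (w * t)))
                 - y0 * exp (b * (w * t)) * sin (w * t)) / w" for t
  define v where "v t = A * (1 + b\<^sup>2) * exp (b * (w * t)) * sin (w * t)
                 - y0 * exp (b * (w * t)) * (b * sin (w * t) + cos (w * t))" for t
  have sol: "is_solution T D a x (\<lambda>t. T * x t - v t)"
    using is_solution_focus[OF _ p] assms(1) unfolding x_def v_def by simp
  have s: "sin t < 0" by (rule sin_neg_pi_2pi[OF t])
  \<comment> \<open>This factorization reduces the sign of \<open>x\<close> to that of
    \<open>sin u\<close> and to comparing the ordinate at time \<open>u\<close> with
    \<open>y0\<close>.\<close>
  have x_eq: "w * x (u / w) = exp (b * u) * sin u * (section_ordinate A b u - y0)" if "sin u \<noteq> 0" for u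
  proof -
    have "exp (b * u) * (section_ordinate A b u * sin u) = A * (1 - exp (b * u) * (cos u - b * sin u))"
      using section_ordinate_mult_sin[of u A b] that exp_add[of "b * u" "- b * u"]
      by simp algebra
    moreover have "w * x (u / w) = A * (1 - exp (b * u) * (cos u - b * sin u)) - y0 * exp (b * u) * sin u"
      using assms(1) by (simp add: x_def)
    ultimately show ?thesis by (simp add: algebra_simps)
  qed
  have "w * x (t / w) = 0" using x_eq[of t] s by (simp add: y0_def)
  then have xt: "x (t / w) = 0" using assms(1) by simp
  have vt: "v (t / w) = - section_ordinate A b (- t)"
  proof -
    have 1: "y0 * sin t = A * (exp (- b * t) - cos t + b * sin t)"
      using section_ordinate_mult_sin[of t A b] s by (simp add: y0_def)
    have 2: "section_ordinate A b (- t) * sin t = A * (cos t + b * sin t - exp (b * t))"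
      using section_ordinate_uminus_mult_sin[of t A b] s by simp
    have e: "exp (b * t) * exp (- b * t) = 1" by (simp flip: exp_add)
    have sc: "(cos t)\<^sup>2 = 1 - (sin t)\<^sup>2" by (rule cos_squared_eq)
    have "v (t / w) * sin t = A * (1 + b\<^sup>2) * exp (b * t) * (sin t)\<^sup>2
        - (y0 * sin t) * exp (b * t) * (b * sin t + cos t)"
      using assms(1) by (simp add: v_def algebra_simps power2_eq_square)
    also have "\<dots> = - (section_ordinate A b (- t) * sin t)"
      unfolding 1 2 using e sc by algebra
    finally have "v (t / w) * sin t = - section_ordinate A b (- t) * sin t" by simp
    then show ?thesis using s by (metis mult_right_cancel less_irrefl)
  qed
  have neg: "x r < 0" if r: "0 < r" "r < t / w" for r
  proof -
    define u where "u = w * r"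
    have u: "0 < u" "u < t" using r assms(1) by (auto simp: u_def field_simps)
    have ru: "r = u / w" using assms(1) by (simp add: u_def)
    \<comment> \<open>Before \<open>pi\<close> the sine is positive and the ordinate lies below 0,
      hence below \<open>y0\<close>. After \<open>pi\<close> both comparisons flip, by strict
      decrease up to \<open>t\<close>. At \<open>pi\<close> the factorization fails and
      \<open>x\<close> is evaluated directly.\<close>
    consider "u < pi" | "u = pi" | "pi < u" by linarith
    then have "w * x r < 0"
    proof cases
      case 1
      then have "0 < sin u" using u by (intro sin_gt_zero) auto
      moreover have "section_ordinate A b u < 0"
        using assms(2) u 1 by (intro section_ordinate_neg)
      ultimately show ?thesis
        unfolding ru using y0 by (subst x_eq) (auto intro!: mult_pos_neg simp: y0_def)
    next
      case 2
      have "w * x r = A * (1 + exp (b * pi))"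
        using assms(1) 2 by (simp add: x_def u_def)
      then show ?thesis using assms(2) by (simp add: mult_neg_pos add_pos_pos)
    next
      case 3
      then have "sin u < 0" using u t by (intro sin_neg_pi_2pi) auto
      moreover have "y0 < section_ordinate A b u"
        unfolding y0_def using assms 3 u t by (intro section_ordinate_strict_antimono)
      ultimately show ?thesis
        unfolding ru by (subst x_eq) (auto simp: mult_less_0_iff)
    qed
    then show ?thesis using assms(1) by (simp add: mult_less_0_iff)
  qed
  show ?thesis
    unfolding left_return_def
  proof (intro exI conjI)
    show "is_solution T D a x (\<lambda>t. T * x t - v t)" by (rule sol)
    show "x 0 = 0" "T * x 0 - v 0 = section_ordinate A b t" by (simp_all add: x_def v_def y0_def)
    show "t / w > 0" using assms(1) t pi_gt_zero by (intro divide_pos_pos) linarith+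
    show "section_ordinate A b (- t) = T * x (t / w) - v (t / w)" by (simp add: xt vt)
  qed (use xt neg in auto)
qed

section \<open>Conditions on \<open>a\<close>, \<open>T\<close> and \<open>D\<close> forced by the
  orbit through the origin\<close>

text \<open>If \<open>a = 0\<close> the origin is an equilibrium. If \<open>a > 0\<close>, then
  \<open>x\<close> and \<open>x'\<close> vanish at 0 while \<open>x'' = a\<close> is positive, so
  the orbit first enters \<open>x > 0\<close>.\<close>

lemma left_return_0_imp_neg:
  assumes "left_return T D a 0 y1"
  shows "a < 0"
proof (rule ccontr)
  obtain x y \<tau> where sol: "is_solution T D a x y" and ini: "x 0 = 0" "y 0 = 0" "\<tau> > 0"
    and neg: "\<And>t. 0 < t \<Longrightarrow> t < \<tau> \<Longrightarrow> x t < 0"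
    using assms unfolding left_return_def by auto
  have dx: "(x has_real_derivative T * x t - y t) (at t)" for t
    using sol by (simp add: is_solution_def)
  have dy: "(y has_real_derivative D * x t - a) (at t)" for t
    using sol by (simp add: is_solution_def)
  assume "\<not> a < 0"
  then consider "a = 0" | "a > 0" by linarith
  then show False
  proof cases
    case 1
    then have "is_solution T D a (\<lambda>_. 0) (\<lambda>_. 0)" by (simp add: is_solution_def)
    from is_solution_unique[OF sol this, of "\<tau> / 2"] neg[of "\<tau> / 2"] ini show False by simp
  next
    case 2
    have "((\<lambda>t. T * x t - y t) has_real_derivative a) (at 0)"
      by (rule derivative_eq_intros dx dy refl)+ (simp add: ini)
    from DERIV_pos_inc_right[OF this 2] obtain d where d: "d > 0"
      "\<And>h. 0 < h \<Longrightarrow> h < d \<Longrightarrow> 0 < T * x h - y h" by (auto simp: ini)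
    define t where "t = min d \<tau> / 2"
    have t: "0 < t" "t < d" "t < \<tau>" using d ini by (auto simp: t_def)
    have "x 0 < x t"
    proof (rule DERIV_pos_imp_increasing_open[OF t(1)])
      show "continuous_on {0..t} x"
        using dx by (intro DERIV_continuous_on) (blast intro: has_field_derivative_at_within)
    qed (use dx d t in \<open>force\<close>)
    then show False using neg[of t] t ini by simp
  qed
qed

lemma left_return_0_imp_trace_pos:
  assumes "left_return T D a 0 y1" "y1 \<noteq> 0"
  shows "T > 0"
proof (rule ccontr)
  obtain x y \<tau> where sol: "is_solution T D a x y" and ini: "x 0 = 0" "y 0 = 0" "\<tau> > 0"
    and ret: "x \<tau> = 0" "y \<tau> = y1"
    using assms unfolding left_return_def by auto
  assume "\<not> T > 0"
  \<comment> \<open>An energy of the form \<open>x'^2 + D * x^2 - 2 * a * x\<close>, with derivative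
    \<open>2 * T * x'^2\<close>. On the section it equals \<open>y\<^sup>2\<close>, so for
    \<open>T \<le> 0\<close> it could not grow from 0 to \<open>y1\<^sup>2 > 0\<close>.\<close>
  define V where "V t = (T * x t - y t)\<^sup>2 + D * (x t)\<^sup>2 - 2 * a * x t" for t
  have dx: "(x has_real_derivative T * x t - y t) (at t)" for t
    using sol by (simp add: is_solution_def)
  have dy: "(y has_real_derivative D * x t - a) (at t)" for t
    using sol by (simp add: is_solution_def)
  have dV: "(V has_real_derivative 2 * T * (T * x t - y t)\<^sup>2) (at t)" for t
    unfolding V_def by (rule derivative_eq_intros dx dy refl)+ (simp, algebra)
  have "2 * T * (T * x t - y t)\<^sup>2 \<le> 0" for t
    using \<open>\<not> T > 0\<close> by (intro mult_nonpos_nonneg[of "2 * T"]) auto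
  then have "V \<tau> \<le> V 0"
    using dV ini(3) by (intro DERIV_nonpos_imp_nonincreasing[of 0 \<tau> V]) (blast intro: less_imp_le)+
  then show False using assms(2) by (simp add: V_def ini ret)
qed

text \<open>For real eigenvalues the operator factors as \<open>(d/dt - l) (d/dt - m)\<close>, and both
  factors preserve negativity from vanishing initial data.\<close>

lemma left_return_0_imp_focus:
  assumes "left_return T D a 0 y1"
  shows "4 * D - T\<^sup>2 > 0"
proof (rule ccontr)
  obtain x y \<tau> where sol: "is_solution T D a x y" and ini: "x 0 = 0" "y 0 = 0" "\<tau> > 0"
    and ret: "x \<tau> = 0"
    using assms unfolding left_return_def by auto
  have dx: "(x has_real_derivative T * x t - y t) (at t)" for t
    using sol by (simp add: is_solution_def)
  have dy: "(y has_real_derivative D * x t - a) (at t)" for t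
    using sol by (simp add: is_solution_def)
  have a: "a < 0" by (rule left_return_0_imp_neg[OF assms])
  assume "\<not> 4 * D - T\<^sup>2 > 0"
  define l where "l = (T + sqrt (T\<^sup>2 - 4 * D)) / 2"
  define m where "m = (T - sqrt (T\<^sup>2 - 4 * D)) / 2"
  have T: "T = l + m" by (simp add: l_def m_def field_simps)
  have "l * m = (T\<^sup>2 - (sqrt (T\<^sup>2 - 4 * D))\<^sup>2) / 4"
    by (simp add: l_def m_def algebra_simps power2_eq_square)
  then have D: "D = l * m" using \<open>\<not> 4 * D - T\<^sup>2 > 0\<close> by simp
  \<comment> \<open>\<open>Z\<close> is \<open>x' - m * x\<close> times the integrating factor for
    \<open>l\<close>. Its negativity then makes \<open>X\<close>, the analogue for \<open>m\<close>,
    decrease strictly, so \<open>x\<close> cannot return to 0.\<close>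
  define Z where "Z t = (T * x t - y t - m * x t) * exp (- l * t)" for t
  have dZ: "(Z has_real_derivative a * exp (- l * t)) (at t)" for t
    unfolding Z_def by (rule derivative_eq_intros dx dy refl)+ (simp add: T D algebra_simps)
  have Z: "Z t < 0" if "t > 0" for t
  proof -
    have "Z t < Z 0"
      by (rule DERIV_neg_imp_decreasing[OF that])
        (use dZ a in \<open>blast intro: mult_neg_pos exp_gt_zero\<close>)
    then show ?thesis by (simp add: Z_def ini)
  qed
  define X where "X t = x t * exp (- m * t)" for t
  have dX: "(X has_real_derivative (T * x t - y t - m * x t) * exp (- m * t)) (at t)" for t
    unfolding X_def by (rule derivative_eq_intros dx refl)+ (simp add: algebra_simps)
  have "X \<tau> < X 0"
  proof (rule DERIV_neg_imp_decreasing_open[OF ini(3)])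
    fix t :: real assume "0 < t"
    then have "(T * x t - y t - m * x t) * exp (- m * t) < 0"
      using Z[of t] by (simp add: Z_def mult_less_0_iff)
    then show "\<exists>y. (X has_real_derivative y) (at t) \<and> y < 0" using dX by blast
  next
    show "continuous_on {0..\<tau>} X"
      using dX by (intro DERIV_continuous_on) (blast intro: has_field_derivative_at_within)
  qed
  then show False by (simp add: X_def ini ret)
qed

section \<open>Taylor coefficients\<close>

text \<open>Since \<open>F * fps_deriv F\<close> is half the derivative of \<open>F * F\<close>, the
  equation is a recursion for the coefficients of \<open>F * F\<close>. Each new coefficient of
  \<open>F\<close> enters linearly, with a factor that is a nonzero multiple of
  \<open>a\<^sup>2 * y\<close>.\<close>

lemma half_map_fps_coeffs:
  fixes F :: "real fps" and T D a y :: real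
  assumes F0: "fps_nth F 0 = y" and nz: "y \<noteq> 0" "a \<noteq> 0"
    and ode: "(fps_const D * fps_X ^ 2 - fps_const (a * T) * fps_X + fps_const (a\<^sup>2)) * (F * fps_deriv F)
       = fps_X * (fps_const D * (F * F) - fps_const (a * T) * F + fps_const (a\<^sup>2))"
  defines "W \<equiv> W_poly T D a y"
  shows "fps_nth F 1 = 0"
    and "fps_nth F 2 = W / (2 * a ^ 2 * y)"
    and "fps_nth F 3 = T * W / (3 * a ^ 3 * y)"
    and "fps_nth F 4 = - ((a ^ 2 + (D - 2 * T ^ 2) * y ^ 2) * W / (8 * a ^ 4 * y ^ 3))"
    and "fps_nth F 5 = - (T * (5 * a ^ 2 + (7 * D - 6 * T ^ 2) * y ^ 2) * W / (30 * a ^ 5 * y ^ 3))"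
    and "fps_nth F 6 = (9 * a ^ 4 - 6 * a ^ 3 * T * y + 2 * a ^ 2 * (9 * D - 13 * T ^ 2) * y ^ 2
              + (9 * D ^ 2 - 46 * D * T ^ 2 + 24 * T ^ 4) * y ^ 4) * W / (144 * a ^ 6 * y ^ 5)"
proof -
  define E where "E = F * fps_deriv F"
  define G where "G = F * F"
  have "fps_deriv G = fps_const 2 * E"
    by (simp add: G_def E_def numeral_fps_const[symmetric])
  then have E: "fps_nth E n = real (n + 1) * fps_nth G (n + 1) / 2" for n
    by (metis fps_deriv_nth fps_mult_left_const_nth mult.commute nonzero_mult_div_cancel_right zero_neq_numeral)
  have ode': "fps_const D * (fps_X * (fps_X * E)) - fps_const (a * T) * (fps_X * E) + fps_const (a\<^sup>2) * E
      = fps_X * (fps_const D * G - fps_const (a * T) * F + fps_const (a\<^sup>2))"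
    using ode unfolding E_def G_def power2_eq_square by (simp only: algebra_simps)
  \<comment> \<open>The index starts at 2 so that the factor \<open>fps_X ^ 2\<close> never shifts
    below the constant term; coefficients 0 and 1 are read off separately.\<close>
  have rec: "a\<^sup>2 * fps_nth E (n + 2) = a * T * fps_nth E (n + 1) - D * fps_nth E n
      + D * fps_nth G (n + 1) - a * T * fps_nth F (n + 1)" for n
    using arg_cong[OF ode', of "\<lambda>H. fps_nth H (n + 2)"] by simp
  have E0: "a\<^sup>2 * fps_nth E 0 = 0"
    using arg_cong[OF ode', of "\<lambda>H. fps_nth H 0"] by simp
  have E1: "a\<^sup>2 * fps_nth E 1 - a * T * fps_nth E 0 = D * fps_nth G 0 - a * T * fps_nth F 0 + a\<^sup>2"
    using arg_cong[OF ode', of "\<lambda>H. fps_nth H 1"] by simp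
  define f1 where "f1 = fps_nth F 1"
  define f2 where "f2 = fps_nth F 2"
  define f3 where "f3 = fps_nth F 3"
  define f4 where "f4 = fps_nth F 4"
  define f5 where "f5 = fps_nth F 5"
  define f6 where "f6 = fps_nth F 6"
  note f_defs = f1_def f2_def f3_def f4_def f5_def f6_def
  have G: "fps_nth G 0 = y * y" "fps_nth G 1 = 2 * y * f1" "fps_nth G 2 = 2 * y * f2 + f1\<^sup>2"
    "fps_nth G 3 = 2 * y * f3 + 2 * f1 * f2" "fps_nth G 4 = 2 * y * f4 + 2 * f1 * f3 + f2\<^sup>2"
    "fps_nth G 5 = 2 * y * f5 + 2 * f1 * f4 + 2 * f2 * f3"
    "fps_nth G 6 = 2 * y * f6 + 2 * f1 * f5 + 2 * f2 * f4 + f3\<^sup>2"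
    by (simp_all add: G_def fps_mult_nth f_defs F0 eval_nat_numeral algebra_simps)
  have "fps_nth E 0 = 0" using E0 nz by simp
  then have f1: "f1 = 0" using E[of 0] G nz by simp
  have E': "fps_nth E 1 = 2 * y * f2" "fps_nth E 2 = 3 * y * f3" "fps_nth E 3 = 2 * (2 * y * f4 + f2\<^sup>2)"
     "fps_nth E 4 = 5 * (y * f5 + f2 * f3)" "fps_nth E 5 = 3 * (2 * y * f6 + 2 * f2 * f4 + f3\<^sup>2)"
    using E[of 1] E[of 2] E[of 3] E[of 4] E[of 5] G f1
    by (simp_all add: eval_nat_numeral algebra_simps)
  have W: "W = D * y\<^sup>2 - a * T * y + a\<^sup>2" by (simp add: W_def W_poly_def)
  have r1: "a\<^sup>2 * (2 * y * f2) = W"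
    using E1 \<open>fps_nth E 0 = 0\<close> G E' F0 by (simp add: W power2_eq_square)
  have r2: "a * (3 * y * f3) = T * (2 * y * f2)"
    using rec[of 0] \<open>fps_nth E 0 = 0\<close> G E' F0 f1 nz
    by (simp add: eval_nat_numeral f1_def mult.assoc)
  have r3: "a\<^sup>2 * (2 * (2 * y * f4 + f2\<^sup>2)) = a * T * (3 * y * f3) - a * T * f2"
    using rec[of 1] G E' f1 by (simp add: f_defs eval_nat_numeral)
  have r4: "a\<^sup>2 * (5 * (y * f5 + f2 * f3)) = a * T * (2 * (2 * y * f4 + f2\<^sup>2)) - D * y * f3 - a * T * f3"
    using rec[of 2] G E' f1 by (simp add: f_defs eval_nat_numeral)
  have r5: "a\<^sup>2 * (3 * (2 * y * f6 + 2 * f2 * f4 + f3\<^sup>2)) = a * T * (5 * (y * f5 + f2 * f3))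
      - D * (2 * y * f4 + f2\<^sup>2) - a * T * f4"
    using rec[of 3] G E' f1 by (simp add: f_defs eval_nat_numeral)
  show 1: "fps_nth F 1 = 0" using f1 by (simp add: f1_def)
  \<comment> \<open>From here on the formulas are cleared of denominators. Each recursion is
    regrouped into the left-hand sides of the earlier formulas, which leaves a polynomial identity
    once \<open>W\<close> is expanded.\<close>
  have p2: "2 * a\<^sup>2 * y * f2 = W" using r1 by (simp add: mult_ac)
  have p3: "3 * a ^ 3 * y * f3 = T * W"
  proof -
    have "3 * a ^ 3 * y * f3 = a\<^sup>2 * (a * (3 * y * f3))"
      by (simp add: power2_eq_square power3_eq_cube)
    also have "\<dots> = T * (a\<^sup>2 * (2 * y * f2))" by (simp add: r2)
    finally show ?thesis by (simp only: r1)
  qed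
  have p4: "8 * a ^ 4 * y ^ 3 * f4 = - ((a ^ 2 + (D - 2 * T ^ 2) * y ^ 2) * W)"
  proof -
    have "8 * a ^ 4 * y ^ 3 * f4 = 2 * T * y\<^sup>2 * (3 * a ^ 3 * y * f3)
        - a * y * T * (2 * a\<^sup>2 * y * f2) - (2 * a\<^sup>2 * y * f2)\<^sup>2"
      using r3 by algebra
    then show ?thesis unfolding p2 p3 unfolding W by algebra
  qed
  have p5: "30 * a ^ 5 * y ^ 3 * f5 = - (T * (5 * a ^ 2 + (7 * D - 6 * T ^ 2) * y ^ 2) * W)"
  proof -
    have "30 * a ^ 5 * y ^ 3 * f5 = 3 * T * (8 * a ^ 4 * y ^ 3 * f4) + 3 * T * (2 * a\<^sup>2 * y * f2)\<^sup>2
        - 2 * y * (D * y + a * T) * (3 * a ^ 3 * y * f3)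
        - 5 * (2 * a\<^sup>2 * y * f2) * (3 * a ^ 3 * y * f3)"
      using r4 by algebra
    then show ?thesis unfolding p2 p3 p4 unfolding W by algebra
  qed
  have p6: "144 * a ^ 6 * y ^ 5 * f6 = (9 * a ^ 4 - 6 * a ^ 3 * T * y + 2 * a ^ 2 * (9 * D - 13 * T ^ 2) * y ^ 2
              + (9 * D ^ 2 - 46 * D * T ^ 2 + 24 * T ^ 4) * y ^ 4) * W"
  proof -
    have "144 * a ^ 6 * y ^ 5 * f6 = 4 * T * y\<^sup>2 * (30 * a ^ 5 * y ^ 3 * f5)
        + 20 * T * y\<^sup>2 * (2 * a\<^sup>2 * y * f2) * (3 * a ^ 3 * y * f3)
        - (6 * D * y\<^sup>2 + 3 * a * y * T) * (8 * a ^ 4 * y ^ 3 * f4)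
        - 6 * D * y\<^sup>2 * (2 * a\<^sup>2 * y * f2)\<^sup>2
        - 9 * (2 * a\<^sup>2 * y * f2) * (8 * a ^ 4 * y ^ 3 * f4) - 8 * y\<^sup>2 * (3 * a ^ 3 * y * f3)\<^sup>2"
      using r5 by algebra
    then show ?thesis unfolding p2 p3 p4 p5 unfolding W by algebra
  qed
  show "fps_nth F 2 = W / (2 * a ^ 2 * y)"
    and "fps_nth F 3 = T * W / (3 * a ^ 3 * y)"
    and "fps_nth F 4 = - ((a ^ 2 + (D - 2 * T ^ 2) * y ^ 2) * W / (8 * a ^ 4 * y ^ 3))"
    and "fps_nth F 5 = - (T * (5 * a ^ 2 + (7 * D - 6 * T ^ 2) * y ^ 2) * W / (30 * a ^ 5 * y ^ 3))"
    and "fps_nth F 6 = (9 * a ^ 4 - 6 * a ^ 3 * T * y + 2 * a ^ 2 * (9 * D - 13 * T ^ 2) * y ^ 2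
              + (9 * D ^ 2 - 46 * D * T ^ 2 + 24 * T ^ 4) * y ^ 4) * W / (144 * a ^ 6 * y ^ 5)"
    unfolding f_defs[symmetric] minus_divide_left
    by ((rule eq_divide_imp, use nz in simp, subst mult.commute, rule p2 p3 p4 p5 p6)+)
qed

section \<open>Transfer to the half-map and assembly of its properties\<close>

theorem proposition2:
  fixes T D a yh :: real
  defines "I \<equiv> left_half_map_domain T D a"
    and "P \<equiv> left_half_map T D a"
    and "W \<equiv> W_poly T D a"
  assumes "a\<^sup>2 + D\<^sup>2 \<noteq> 0"
    and "0 \<in> I"
    and "P 0 = yh" and "yh < 0"
  shows "a < 0 \<and> T > 0 \<and> 4 * D - T\<^sup>2 > 0 \<and>
    is_interval (P ` I) \<and> yh \<in> P ` I \<and> (\<forall>y\<in>P ` I. y \<le> yh) \<and>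
    real_analytic_in P I \<and>
    eventually (\<lambda>y0. y0 \<in> I) (at_right 0) \<and>
    (\<lambda>y0. P y0 -
        (yh + W yh * y0 ^ 2 / (2 * a ^ 2 * yh)
          + T * W yh * y0 ^ 3 / (3 * a ^ 3 * yh)
          - (a ^ 2 + (D - 2 * T ^ 2) * yh ^ 2) * W yh * y0 ^ 4 / (8 * a ^ 4 * yh ^ 3)
          - T * (5 * a ^ 2 + (7 * D - 6 * T ^ 2) * yh ^ 2) * W yh * y0 ^ 5
              / (30 * a ^ 5 * yh ^ 3)
          + (9 * a ^ 4 - 6 * a ^ 3 * T * yh + 2 * a ^ 2 * (9 * D - 13 * T ^ 2) * yh ^ 2
              + (9 * D ^ 2 - 46 * D * T ^ 2 + 24 * T ^ 4) * yh ^ 4) * W yh * y0 ^ 6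
              / (144 * a ^ 6 * yh ^ 5)))
      \<in> O[at_right 0](\<lambda>y0. y0 ^ 7)"
proof -
  obtain y1 where y1: "left_half_map_graph T D a 0 y1"
    using assms(5) by (auto simp: I_def left_half_map_domain_def)
  \<comment> \<open>The extension by \<open>P(0) = 0\<close> is excluded because
    \<open>yh < 0\<close>, so the orbit of the origin really returns.\<close>
  have ret0: "left_return T D a 0 yh"
    using y1 left_half_map_eqI[OF y1] assms(6,7) by (auto simp: P_def left_half_map_graph_def)
  have a: "a < 0" by (rule left_return_0_imp_neg[OF ret0])
  have T: "T > 0" using left_return_0_imp_trace_pos[OF ret0] assms(7) by simp
  have disc: "4 * D - T\<^sup>2 > 0" by (rule left_return_0_imp_focus[OF ret0])
  then have D: "D > 0" using zero_le_power2[of T] by linarith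
  \<comment> \<open>\<open>w\<close> is the imaginary part of the eigenvalues, \<open>b\<close> the
    ratio of their real to their imaginary part, and \<open>A\<close> is fixed by
    \<open>a = A * w * (1 + b\<^sup>2)\<close>.\<close>
  define w where "w = sqrt (D - T\<^sup>2 / 4)"
  define b where "b = T / (2 * w)"
  define A where "A = a * w / D"
  have w: "w > 0" using disc by (simp add: w_def)
  have b: "b > 0" using T w by (simp add: b_def)
  have A: "A < 0" using a w D by (simp add: A_def divide_neg_pos mult_neg_pos)
  have pT: "T = 2 * b * w" using w by (simp add: b_def)
  have "w\<^sup>2 = D - T\<^sup>2 / 4" using disc by (simp add: w_def)
  moreover have "w\<^sup>2 * b\<^sup>2 = T\<^sup>2 / 4"
    using w by (simp add: b_def power_divide)
  ultimately have pD: "D = w\<^sup>2 * (1 + b\<^sup>2)" by (simp add: distrib_left)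
  have pa: "a = A * w * (1 + b\<^sup>2)"
  proof -
    have "A * w * (1 + b\<^sup>2) = a * (w\<^sup>2 * (1 + b\<^sup>2)) / D"
      by (simp add: A_def power2_eq_square)
    also have "\<dots> = a" unfolding pD[symmetric] using D by simp
    finally show ?thesis by simp
  qed
  define Q where "Q = left_return_ordinate A b"
  have ret: "left_return T D a y0 (Q y0)" if "y0 \<ge> 0" for y0
  proof -
    obtain t where t: "pi < t" "t < 2 * pi" "section_ordinate A b t = y0"
      by (rule section_ordinate_surj[OF A b])
    have "left_return T D a (section_ordinate A b t) (section_ordinate A b (- t))"
      using left_return_section_ordinate[OF w A b pT pD pa t(1,2)] t that by simp
    then show ?thesis
      using left_return_ordinate_section_ordinate[OF A b t(1,2)] by (simp add: Q_def t)
  qed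
  have PQ: "P y0 = Q y0" if "y0 \<ge> 0" for y0
    unfolding P_def using ret that by (intro left_half_map_eqI) (simp add: left_half_map_graph_def)
  have I: "I = {0..}"
    using ret by (auto simp: I_def left_half_map_domain_def left_half_map_graph_def)
  have Q0: "Q 0 = yh" using PQ[of 0] assms(6) by simp
  have an: "real_analytic_at Q y" for y
    unfolding Q_def by (rule real_analytic_at_left_return_ordinate[OF A b])
  have dQ: "(Q has_real_derivative deriv Q y) (at y)" for y
    by (rule field_differentiable_derivI) (rule real_analytic_at_imp_differentiable[OF an])
  have ode: "W_poly T D a y * (Q y * deriv Q y) = y * W_poly T D a (Q y)" for y
    unfolding Q_def by (rule left_return_ordinate_ode[OF A b pT pD pa])
  \<comment> \<open>In the sum of squares below, the second term is positive unless
    \<open>y = 0\<close>, where the first equals \<open>a\<^sup>2\<close>.\<close>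
  have W_pos: "W_poly T D a y > 0" for y
  proof -
    have "W_poly T D a y = (T * y / 2 - a)\<^sup>2 + (4 * D - T\<^sup>2) / 4 * y\<^sup>2"
      by (simp add: W_poly_def field_simps power2_eq_square)
    then show ?thesis using a disc
      by (cases "y = 0") (auto intro!: add_nonneg_pos)
  qed
  have Q_neg: "Q y < 0" for y
  proof -
    obtain t where t: "pi < t" "t < 2 * pi" "section_ordinate A b t = y"
      by (rule section_ordinate_surj[OF A b])
    then show ?thesis
      using left_return_ordinate_section_ordinate[OF A b t(1,2)] section_ordinate_uminus_neg[OF A b t(1,2)]
      by (simp add: Q_def)
  qed
  \<comment> \<open>With \<open>W_poly\<close> positive and \<open>Q\<close> negative, a positive
    derivative would make the left side of the differential equation negative while the right side
    is nonnegative.\<close>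
  have dQ_nonpos: "deriv Q y \<le> 0" if "y \<ge> 0" for y
  proof (rule ccontr)
    assume "\<not> deriv Q y \<le> 0"
    then have "W_poly T D a y * (Q y * deriv Q y) < 0"
      using W_pos[of y] Q_neg[of y] by (intro mult_pos_neg mult_neg_pos) auto
    moreover have "0 \<le> y * W_poly T D a (Q y)" using that W_pos[of "Q y"] by simp
    ultimately show False using ode[of y] by simp
  qed
  have Q_le: "Q y \<le> yh" if "y \<ge> 0" for y
    unfolding Q0[symmetric]
    by (rule DERIV_nonpos_imp_nonincreasing[OF that]) (use dQ dQ_nonpos in blast)
  have image: "P ` I = Q ` {0..}" using PQ by (auto simp: I)
  have "continuous_on {0..} Q"
    by (rule DERIV_continuous_on) (rule has_field_derivative_at_within[OF dQ])
  then have interval: "is_interval (P ` I)"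
    unfolding image by (simp add: is_interval_connected_1 connected_continuous_image)
  have analytic: "real_analytic_in P I"
    unfolding real_analytic_in_def
    \<comment> \<open>The witness \<open>Q\<close> is analytic on the whole line, so the endpoint 0
      needs no separate treatment.\<close>
    by (intro ballI exI[of _ UNIV] exI[of _ Q]) (auto simp: an I PQ)
  have ev: "eventually (\<lambda>y0. y0 \<in> I) (at_right 0)"
    using eventually_at_right_less[of "0::real"] by (rule eventually_mono) (simp add: I)
  obtain F where F: "Q has_fps_expansion F"
    by (rule real_analytic_at_imp_has_fps_expansion_0[OF an])
  \<comment> \<open>The differential equation holds for all real \<open>y\<close>, hence on a
    two-sided neighbourhood of 0, which forces the corresponding identity of formal power
    series.\<close>
  have "(\<lambda>y. (D * y ^ 2 - (a * T) * y + a\<^sup>2) * (Q y * deriv Q y)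
      - y * (D * (Q y * Q y) - (a * T) * Q y + a\<^sup>2)) has_fps_expansion
      (fps_const D * fps_X ^ 2 - fps_const (a * T) * fps_X + fps_const (a\<^sup>2)) * (F * fps_deriv F)
       - fps_X * (fps_const D * (F * F) - fps_const (a * T) * F + fps_const (a\<^sup>2))"
    by (intro fps_expansion_intros F)
  then have "(fps_const D * fps_X ^ 2 - fps_const (a * T) * fps_X + fps_const (a\<^sup>2)) * (F * fps_deriv F)
       - fps_X * (fps_const D * (F * F) - fps_const (a * T) * F + fps_const (a\<^sup>2)) = 0"
    by (rule has_fps_expansion_real_eq_0) (use ode in \<open>simp add: W_poly_def power2_eq_square\<close>)
  then have fps_ode: "(fps_const D * fps_X ^ 2 - fps_const (a * T) * fps_X + fps_const (a\<^sup>2)) * (F * fps_deriv F)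
       = fps_X * (fps_const D * (F * F) - fps_const (a * T) * F + fps_const (a\<^sup>2))"
    by simp
  have F0: "fps_nth F 0 = yh"
    using has_fps_expansion_imp_0_eq_fps_nth_0[OF F] Q0 by simp
  note coeffs = half_map_fps_coeffs[OF F0 _ _ fps_ode]
  have sum: "(\<Sum>k<7. fps_nth F k * y ^ k) =
      yh + W yh * y ^ 2 / (2 * a ^ 2 * yh)
          + T * W yh * y ^ 3 / (3 * a ^ 3 * yh)
          - (a ^ 2 + (D - 2 * T ^ 2) * yh ^ 2) * W yh * y ^ 4 / (8 * a ^ 4 * yh ^ 3)
          - T * (5 * a ^ 2 + (7 * D - 6 * T ^ 2) * yh ^ 2) * W yh * y ^ 5
              / (30 * a ^ 5 * yh ^ 3)
          + (9 * a ^ 4 - 6 * a ^ 3 * T * yh + 2 * a ^ 2 * (9 * D - 13 * T ^ 2) * yh ^ 2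
              + (9 * D ^ 2 - 46 * D * T ^ 2 + 24 * T ^ 4) * yh ^ 4) * W yh * y ^ 6
              / (144 * a ^ 6 * yh ^ 5)" for y
  proof -
    have 7: "{..<7} = {0, 1, 2, 3, 4, 5, 6::nat}" by auto
    have nz: "yh \<noteq> 0" "a \<noteq> 0" using a assms(7) by auto
    show ?thesis
      unfolding 7 W_def by (simp add: F0 coeffs[OF nz, unfolded One_nat_def])
  qed
  have "(\<lambda>y. Q y - (\<Sum>k<7. fps_nth F k * y ^ k)) \<in> O[at_right 0](\<lambda>y. y ^ 7)"
    by (rule has_fps_expansion_taylor_bigo[OF F])
  \<comment> \<open>\<open>P\<close> is known to agree with \<open>Q\<close> only for nonnegative
    arguments, which suffices for the one-sided filter.\<close>
  also have "?this \<longleftrightarrow> (\<lambda>y. P y - (\<Sum>k<7. fps_nth F k * y ^ k)) \<in> O[at_right 0](\<lambda>y. y ^ 7)"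
    by (intro landau_o.big.in_cong eventually_mono[OF eventually_at_right_less[of "0::real"]])
      (simp add: PQ)
  finally have taylor: "(\<lambda>y. P y - (\<Sum>k<7. fps_nth F k * y ^ k)) \<in> O[at_right 0](\<lambda>y. y ^ 7)" .
  have "yh \<in> P ` I" using assms(5,6) by blast
  moreover have "\<forall>y\<in>P ` I. y \<le> yh" unfolding image using Q_le by auto
  ultimately show ?thesis
    using a T disc interval analytic ev taylor[unfolded sum] by blast
qed

end
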